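(* Let $\mathcal{X}$ be a nonempty Polish space, $\mathcal{Y}=\mathbb{R}^d$, $p\ge1$, $\nu\in\mathcal{P}_p(\mathcal{Y})$, and let $\phi:\mathcal{X}\to\mathcal{Y}$ be measurable. Suppose that $\phi$ is continuous and that $|\phi|$ has totally bounded sublevel sets, i.e. $\{x\in\mathcal{X}:|\phi(x)|\le c\}$ is totally bounded for every $c\in\mathbb{R}$. Then there exists a minimizer of $\sigma\mapsto W_p^p(\phi\#\sigma,\nu)$ over $\sigma\in\mathcal{P}(\mathcal{X})$.
   Context: $\mathcal{X}$ is equipped with a fixed complete metric inducing its (Polish) topology; total boundedness refers to this metric. $\mathcal{P}(\cdot)$ denotes Borel probability measures, $\mathcal{P}_p(\mathcal{Y})$ those with finite $p$-th moment $\int|y|^p\,d\mu(y)$. $\phi\#\sigma$ is the pushforward of $\sigma$ by $\phi$. $W_p^p(\mu_1,\mu_2)=\inf_\Gamma\int|y'-y|^p\,d\Gamma(y',y)\in[0,\infty]$, the infimum over couplings of $\mu_1,\mu_2$. A minimizer is any $\sigma_*\in\mathcal{P}(\mathcal{X})$ attaining the infimum. *)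

theory Defs
  imports "HOL-Probability.Probability"
begin

definition borel_probs :: "'a::topological_space measure set"
  where "borel_probs = space (prob_algebra borel)"

lemma borel_probs_iff: "\<mu> \<in> borel_probs \<longleftrightarrow> sets \<mu> = sets borel \<and> prob_space \<mu>"
  by (simp add: borel_probs_def space_prob_algebra)

definition borel_probs_moment :: "real \<Rightarrow> 'a::real_normed_vector measure set"
  where "borel_probs_moment p = {\<mu> \<in> borel_probs. (\<integral>\<^sup>+ y. ennreal (norm y powr p) \<partial>\<mu>) < \<infinity>}"

definition couplings ::
    "'a::topological_space measure \<Rightarrow> 'b::topological_space measure \<Rightarrow> ('a \<times> 'b) measure set"
  where "couplings \<mu>\<^sub>1 \<mu>\<^sub>2 =
    {\<Gamma> \<in> borel_probs. distr \<Gamma> borel fst = \<mu>\<^sub>1 \<and> distr \<Gamma> borel snd = \<mu>\<^sub>2}"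

text \<open>This is the \<open>p\<close>-th power of the Wasserstein distance, with values in \<open>[0, \<infinity>]\<close>.\<close>
definition wasserstein_pow ::
    "real \<Rightarrow> 'a::real_normed_vector measure \<Rightarrow> 'a measure \<Rightarrow> ennreal"
  where "wasserstein_pow p \<mu>\<^sub>1 \<mu>\<^sub>2 =
    (INF \<Gamma>\<in>couplings \<mu>\<^sub>1 \<mu>\<^sub>2. \<integral>\<^sup>+ (y', y). ennreal (norm (y' - y) powr p) \<partial>\<Gamma>)"

definition attains_inf_on :: "('a \<Rightarrow> 'b::Inf) \<Rightarrow> 'a set \<Rightarrow> 'a \<Rightarrow> bool"
  where "attains_inf_on F S x \<longleftrightarrow> x \<in> S \<and> F x = (INF y\<in>S. F y)"

end

(* The cost is bounded below pointwise: every coupling of a law carried by the range of phi with nu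
   costs at least the integral of dist(y, range phi)^p against nu. The sublevel sets of |phi| are
   compact, so phi is proper, its range is closed, and for each y the set A(y) of those x for which
   phi(x) is a point of the range nearest to y is nonempty and compact. A measurable selection s of
   A turns the lower bound into an equality, attained by the coupling (phi o s, id)#nu; hence s#nu is a
   minimizer, and no weak compactness argument is needed. *)
theory Submission
  imports Defs
begin

section \<open>Measurable selection from compact sets\<close>

lemma compact_infdist_attained:
  fixes S :: "'a::metric_space set"
  assumes "compact S" "S \<noteq> {}"
  obtains x where "x \<in> S" "dist q x = infdist q S"
proof -
  have "continuous_on S (dist q)"
    by (intro continuous_intros)
  from continuous_attains_inf[OF assms this] obtain x
    where x: "x \<in> S" "\<And>y. y \<in> S \<Longrightarrow> dist q x \<le> dist q y" by blast
  have "dist q x \<le> infdist q S"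
    unfolding infdist_notempty[OF assms(2)] using assms(2) x(2) by (intro cINF_greatest) auto
  with infdist_le[OF x(1), of q] x(1) that show thesis by force
qed

text \<open>The metric projection of \<open>q\<close> onto \<open>S\<close>. The closed ball form
  makes compactness immediate; on \<open>S\<close> the reverse inequality of distances is
  automatic.\<close>

definition nearest_points :: "'a::metric_space \<Rightarrow> 'a set \<Rightarrow> 'a set"
  where "nearest_points q S = S \<inter> cball q (infdist q S)"

lemma nearest_points_subset: "nearest_points q S \<subseteq> S"
  by (auto simp: nearest_points_def)

lemma compact_nearest_points: "compact S \<Longrightarrow> compact (nearest_points q S)"
  unfolding nearest_points_def by (intro compact_Int_closed closed_cball)

lemma nearest_points_nonempty: "compact S \<Longrightarrow> S \<noteq> {} \<Longrightarrow> nearest_points q S \<noteq> {}"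
  by (rule compact_infdist_attained[of S q]) (auto simp: nearest_points_def)

lemma dist_nearest_points: "x \<in> nearest_points q S \<Longrightarrow> dist q x = infdist q S"
  by (auto simp: nearest_points_def intro: antisym infdist_le)

(* Testing rational radii only is what makes hitting sets of the nearest points measurable. *)
lemma nearest_points_meets_closed_iff:
  assumes S: "compact S" "S \<noteq> {}" and C: "closed C"
  shows "nearest_points q S \<inter> C \<noteq> {} \<longleftrightarrow>
    (\<forall>r::rat. S \<inter> cball q (of_rat r) \<noteq> {} \<longrightarrow> S \<inter> (C \<inter> cball q (of_rat r)) \<noteq> {})"
    (is "?L \<longleftrightarrow> ?R")
proof
  assume ?L
  then obtain x where x: "x \<in> S" "x \<in> C" "dist q x \<le> infdist q S"
    by (auto simp: nearest_points_def)
  show ?R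
  proof (intro allI impI)
    fix r :: rat
    assume "S \<inter> cball q (of_rat r) \<noteq> {}"
    then obtain z where "z \<in> S" "dist q z \<le> of_rat r" by auto
    then have "dist q x \<le> of_rat r"
      using infdist_le[of z S q] x(3) by linarith
    with x show "S \<inter> (C \<inter> cball q (of_rat r)) \<noteq> {}" by auto
  qed
next
  assume R: ?R
  obtain z where z: "z \<in> S" "dist q z = infdist q S"
    using compact_infdist_attained[OF S] .
  have above: "S \<inter> (C \<inter> cball q (of_rat r)) \<noteq> {}" if "infdist q S < of_rat r" for r
  proof -
    have "z \<in> S \<inter> cball q (of_rat r)" using z that by auto
    with R show ?thesis by blast
  qed
  \<comment> \<open>Any rational radius above \<open>infdist q S\<close> gives a point of
    \<open>S \<inter> C\<close>, so that a nearest point in this set can be taken.\<close>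
  obtain r where "infdist q S < of_rat r"
    using of_rat_dense[of "infdist q S" "infdist q S + 1"] by auto
  from above[OF this] have "S \<inter> C \<noteq> {}" by blast
  then obtain x where x: "x \<in> S \<inter> C" "dist q x = infdist q (S \<inter> C)"
    using compact_infdist_attained[OF compact_Int_closed[OF S(1) C]] by blast
  \<comment> \<open>Otherwise a rational radius strictly between the two distances would produce a
    point of \<open>S \<inter> C\<close> closer to \<open>q\<close> than \<open>x\<close>.\<close>
  have "dist q x \<le> infdist q S"
  proof (rule ccontr)
    assume "\<not> dist q x \<le> infdist q S"
    then obtain r where r: "infdist q S < of_rat r" "of_rat r < dist q x"
      using of_rat_dense[of "infdist q S" "dist q x"] by auto
    from above[OF r(1)] obtain w where "w \<in> S \<inter> C" "w \<in> cball q (of_rat r)" by blast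
    then have "w \<in> S \<inter> C" "dist q w \<le> of_rat r" by simp_all
    with infdist_le[of w "S \<inter> C" q] x(2) r(2) show False by linarith
  qed
  with x(1) show ?L by (auto simp: nearest_points_def)
qed

text \<open>A dense point within half of \<open>dist x y\<close> of \<open>x\<close> would be
  equally close to \<open>y\<close>, against the triangle inequality. This makes the limit of the
  selection process a single point.\<close>

lemma eq_if_dist_dense_eq:
  fixes x y :: "'a::metric_space"
  assumes dense: "\<And>U. open U \<Longrightarrow> U \<noteq> {} \<Longrightarrow> \<exists>n. q n \<in> U"
    and eq: "\<And>n::nat. dist (q n) x = dist (q n) y"
  shows "x = y"
proof (rule ccontr)
  assume "x \<noteq> y"
  then obtain n where "q n \<in> ball x (dist x y / 2)"
    using dense[of "ball x (dist x y / 2)"] by auto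
  then have "dist (q n) x < dist x y / 2" "dist (q n) y < dist x y / 2"
    using eq[of n] by (auto simp: dist_commute)
  then show False by (metis dist_triangle_half_r less_irrefl)
qed

(* Minimizing successively the distances to the points of a dense sequence shrinks
   each A y to a single point. *)
theorem compact_measurable_selection:
  fixes A :: "'y \<Rightarrow> 'x::{metric_space, second_countable_topology} set"
  assumes compact: "\<And>y. compact (A y)" and nonempty: "\<And>y. A y \<noteq> {}"
    and measurable: "\<And>C. closed C \<Longrightarrow> {y \<in> space M. A y \<inter> C \<noteq> {}} \<in> sets M"
  obtains s where "s \<in> borel_measurable M" "\<And>y. s y \<in> A y"
proof -
  obtain D :: "'x set" where D: "countable D" "\<And>U. open U \<Longrightarrow> U \<noteq> {} \<Longrightarrow> \<exists>d\<in>D. d \<in> U"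
    by (rule countable_dense_setE) blast
  define q where "q = from_nat_into D"
  \<comment> \<open>Nonemptiness ensures that \<open>q\<close> enumerates exactly \<open>D\<close>,
    possibly with repetitions.\<close>
  have "D \<noteq> {}" using D(2)[of UNIV] by auto
  then have dense: "\<exists>n. q n \<in> U" if "open U" "U \<noteq> {}" for U
    using D(2)[OF that] from_nat_into_surj[OF D(1)] unfolding q_def by metis
  define B where "B n y = rec_nat (A y) (\<lambda>n. nearest_points (q n)) n" for n y
  have B0: "B 0 y = A y" and BSuc: "B (Suc n) y = nearest_points (q n) (B n y)" for n y
    by (simp_all add: B_def)
  have B: "compact (B n y)" "B n y \<noteq> {}" for n y
    by (induction n)
       (auto simp: B0 BSuc compact nonempty compact_nearest_points nearest_points_nonempty)
  \<comment> \<open>The induction must range over all closed \<open>C\<close>, since one more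
    minimization replaces \<open>C\<close> by its intersections with balls of rational radius, a
    countable family of tests.\<close>
  have B_meas: "{y \<in> space M. B n y \<inter> C \<noteq> {}} \<in> sets M" if "closed C" for n C
    using that
  proof (induction n arbitrary: C)
    case 0
    then show ?case by (simp add: B0 measurable)
  next
    case (Suc n)
    show ?case
      unfolding BSuc nearest_points_meets_closed_iff[OF B Suc.prems]
      by (intro sets.sets_Collect_countable_All sets.sets_Collect_imp Suc.IH
          closed_Int closed_cball Suc.prems)
  qed
  have decr: "B n y \<subseteq> B m y" if "m \<le> n" for m n y
    by (rule lift_Suc_antimono_le[OF _ that]) (simp add: BSuc nearest_points_subset)
  \<comment> \<open>Finite intersection property in \<open>A y\<close>: the sets decrease, so
    finitely many of them share the one of largest index. \<open>C = UNIV\<close> yields existence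
    of the selected point, general \<open>C\<close> its measurability.\<close>
  have meets: "A y \<inter> (\<Inter>n. B n y \<inter> C) \<noteq> {}"
    if "closed C" "\<And>n. B n y \<inter> C \<noteq> {}" for y C
  proof (rule compact_imp_fip_image[OF compact])
    show "closed (B n y \<inter> C)" for n
      by (intro closed_Int compact_imp_closed B that(1))
    fix I :: "nat set"
    assume "finite I"
    then obtain N where "\<And>n. n \<in> I \<Longrightarrow> n \<le> N"
      by (auto simp: finite_nat_set_iff_bounded_le)
    then have "B N y \<subseteq> A y" "\<And>n. n \<in> I \<Longrightarrow> B N y \<subseteq> B n y"
      using decr[of 0 N y] decr by (simp_all add: B0)
    with that(2)[of N] show "A y \<inter> (\<Inter>n\<in>I. B n y \<inter> C) \<noteq> {}" by blast
  qed
  have "\<exists>x. \<forall>n. x \<in> B n y" for y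
    using meets[of UNIV y] B(2) by fastforce
  then obtain s where s: "s y \<in> B n y" for n y
    by metis
  have unique: "x = s y" if "\<And>n. x \<in> B n y" for x y
  proof (rule eq_if_dist_dense_eq[OF dense])
    \<comment> \<open>Stage \<open>Suc n\<close> is the one that fixes the distance to
      \<open>q n\<close>.\<close>
    show "dist (q n) x = dist (q n) (s y)" for n
      using that[of "Suc n"] s[of y "Suc n"] dist_nearest_points unfolding BSuc by metis
  qed
  \<comment> \<open>The stages shrink to the point \<open>s y\<close>, so by compactness it lies in
    \<open>C\<close> as soon as every stage meets \<open>C\<close>. Preimages of closed sets thus
    become countable intersections.\<close>
  have s_iff: "s y \<in> C \<longleftrightarrow> (\<forall>n. B n y \<inter> C \<noteq> {})" if "closed C" for C y
  proof
    show "\<forall>n. B n y \<inter> C \<noteq> {}" if "s y \<in> C" using that s by blast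
    assume "\<forall>n. B n y \<inter> C \<noteq> {}"
    with meets[OF that, of y] obtain x where "\<And>n. x \<in> B n y" "x \<in> C" by auto
    with unique show "s y \<in> C" by blast
  qed
  have "s \<in> borel_measurable M"
    unfolding borel_eq_closed
  proof (rule measurable_measure_of)
    fix C :: "'x set"
    assume "C \<in> Collect closed"
    then have C: "closed C" by simp
    have "s -` C \<inter> space M = {y \<in> space M. \<forall>n. B n y \<inter> C \<noteq> {}}"
      using s_iff[OF C] by auto
    also have "\<dots> \<in> sets M"
      by (intro sets.sets_Collect_countable_All B_meas C)
    finally show "s -` C \<inter> space M \<in> sets M" .
  qed auto
  moreover have "s y \<in> A y" for y using s[of y 0] by (simp add: B0)
  ultimately show thesis by (rule that)
qed

section \<open>Nearest-point selections of proper maps\<close>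

text \<open>The passage from the assumption on sublevel sets to properness, through completeness of
  the metric.\<close>

lemma totally_bounded_closed_imp_compact:
  fixes S :: "'a::complete_space set"
  assumes "totally_bounded S" "closed S"
  shows "compact S"
  unfolding compact_eq_totally_bounded
  using assms by (auto simp: complete_eq_closed totally_bounded_metric ball_def)

text \<open>A convergent sequence of values is bounded, so its preimages can be taken in one compact
  sublevel set; the image of the part of \<open>C\<close> in it is compact and contains the
  limit.\<close>

lemma closed_image_if_compact_sublevels:
  fixes f :: "'x::topological_space \<Rightarrow> 'y::real_normed_vector"
  assumes cont: "continuous_on UNIV f" and compact: "\<And>c. compact {x. norm (f x) \<le> c}"
    and C: "closed C"
  shows "closed (f ` C)"
  unfolding closed_sequential_limits
proof (intro allI impI, elim conjE)
  fix u l
  assume u: "\<forall>n. u n \<in> f ` C" and lim: "u \<longlonglongrightarrow> l"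
  obtain c where c: "\<And>n. norm (u n) \<le> c"
    using convergent_imp_bounded[OF lim] unfolding bounded_iff by auto
  have "compact (f ` ({x. norm (f x) \<le> c} \<inter> C))"
    by (intro compact_continuous_image continuous_on_subset[OF cont] compact_Int_closed compact C) auto
  then have "closed (f ` ({x. norm (f x) \<le> c} \<inter> C))" by (rule compact_imp_closed)
  moreover have "u n \<in> f ` ({x. norm (f x) \<le> c} \<inter> C)" for n using u c[of n] by force
  ultimately have "l \<in> f ` ({x. norm (f x) \<le> c} \<inter> C)"
    using lim by (rule closed_sequentially)
  then show "l \<in> f ` C" by blast
qed

text \<open>Selecting in the domain merges projection onto the range and lifting through
  \<open>f\<close> into one measurable choice.\<close>

lemma nearest_value_selection:
  fixes f :: "'x::{metric_space, second_countable_topology} \<Rightarrow> 'y::euclidean_space"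
  assumes cont: "continuous_on UNIV f" and compact: "\<And>c. compact {x. norm (f x) \<le> c}"
  obtains s where "s \<in> borel_measurable borel"
    "\<And>y. dist y (f (s y)) = infdist y (range f)"
proof -
  define A where "A y = {x. dist y (f x) = infdist y (range f)}" for y
  have image_closed: "closed (f ` C)" if "closed C" for C
    using closed_image_if_compact_sublevels[OF cont compact that] .
  have A_compact: "compact (A y)" for y
  proof -
    \<comment> \<open>By the triangle inequality, values nearest to \<open>y\<close> have bounded
      norm.\<close>
    have "A y \<subseteq> {x. norm (f x) \<le> norm y + infdist y (range f)}"
    proof
      fix x assume "x \<in> A y"
      then have "norm (y - f x) = infdist y (range f)" by (simp add: A_def dist_norm)
      with norm_triangle_ineq2[of "f x" y]
      show "x \<in> {x. norm (f x) \<le> norm y + infdist y (range f)}"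
        by (simp add: norm_minus_commute)
    qed
    moreover have "closed (A y)"
      unfolding A_def by (intro closed_Collect_eq continuous_intros cont)
    ultimately show ?thesis
      using compact_Int_closed[OF compact] by (metis inf.absorb2)
  qed
  have A_nonempty: "A y \<noteq> {}" for y
  proof -
    obtain z where "z \<in> range f" "infdist y (range f) = dist y z"
      using infdist_attains_inf[OF image_closed[OF closed_UNIV]] by blast
    then show ?thesis by (auto simp: A_def)
  qed
  have "{y \<in> space borel. A y \<inter> C \<noteq> {}} \<in> sets borel" if C: "closed C" for C
  proof (cases "C = {}")
    case False
    \<comment> \<open>Closed images attain their distances, so hitting \<open>C\<close> is an
      equality of two continuous functions of \<open>y\<close>. Empty \<open>C\<close> is treated
      apart, because \<open>infdist y {} = 0\<close> by convention.\<close>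
    have "A y \<inter> C \<noteq> {} \<longleftrightarrow> infdist y (f ` C) = infdist y (range f)" for y
    proof
      assume "A y \<inter> C \<noteq> {}"
      then obtain x where "x \<in> C" "dist y (f x) = infdist y (range f)" by (auto simp: A_def)
      moreover have "infdist y (range f) \<le> infdist y (f ` C)"
        using False by (intro infdist_mono) auto
      ultimately show "infdist y (f ` C) = infdist y (range f)"
        using infdist_le[of "f x" "f ` C" y] by auto
    next
      assume "infdist y (f ` C) = infdist y (range f)"
      moreover obtain z where "z \<in> f ` C" "infdist y (f ` C) = dist y z"
        using infdist_attains_inf[OF image_closed[OF C]] False by blast
      ultimately show "A y \<inter> C \<noteq> {}" by (auto simp: A_def)
    qed
    moreover have "closed {y. infdist y (f ` C) = infdist y (range f)}"
      by (intro closed_Collect_eq continuous_intros)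
    ultimately show ?thesis by (auto intro: borel_closed)
  qed auto
  from compact_measurable_selection[OF A_compact A_nonempty this] obtain s
    where "s \<in> borel_measurable borel" "\<And>y. s y \<in> A y" by blast
  then show thesis using that unfolding A_def by blast
qed

section \<open>Transport cost to a closed set\<close>

lemma borel_measurable_powr_cost [measurable]:
  "(\<lambda>(y', y). ennreal (norm (y' - y :: 'a::euclidean_space) powr p)) \<in> borel_measurable borel"
  unfolding case_prod_beta borel_prod[symmetric] by measurable

text \<open>Under any coupling the first coordinate lies almost surely in \<open>K\<close>, so the
  cost dominates a function of the second coordinate alone, whose integral is fixed by the marginal
  \<open>\<nu>\<close>.\<close>

lemma wasserstein_pow_ge_infdist:
  fixes \<mu> \<nu> :: "'a::euclidean_space measure"
  assumes p: "p \<ge> 0" and K: "closed K" "AE y in \<mu>. y \<in> K"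
  shows "wasserstein_pow p \<mu> \<nu> \<ge> (\<integral>\<^sup>+ y. ennreal (infdist y K powr p) \<partial>\<nu>)"
  unfolding wasserstein_pow_def
proof (rule INF_greatest)
  fix \<Gamma> :: "('a \<times> 'a) measure"
  assume "\<Gamma> \<in> couplings \<mu> \<nu>"
  then have sets: "sets \<Gamma> = sets borel"
    and \<mu>: "\<mu> = distr \<Gamma> borel fst" and \<nu>: "\<nu> = distr \<Gamma> borel snd"
    by (auto simp: couplings_def borel_probs_iff)
  have fst: "fst \<in> borel_measurable \<Gamma>" and snd: "snd \<in> borel_measurable \<Gamma>"
    unfolding measurable_cong_sets[OF sets refl] borel_prod[symmetric] by measurable
  have infdist [measurable]: "(\<lambda>y. infdist y K) \<in> borel_measurable borel"
    by (intro borel_measurable_continuous_onI continuous_intros)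
  have "AE z in \<Gamma>. fst z \<in> K"
    using K unfolding \<mu> by (subst (asm) AE_distr_iff[OF fst]) (auto intro: borel_closed)
  have "(\<integral>\<^sup>+ y. ennreal (infdist y K powr p) \<partial>\<nu>) = (\<integral>\<^sup>+ z. ennreal (infdist (snd z) K powr p) \<partial>\<Gamma>)"
    unfolding \<nu> by (intro nn_integral_distr snd) measurable
  also have "\<dots> \<le> (\<integral>\<^sup>+ (y', y). ennreal (norm (y' - y) powr p) \<partial>\<Gamma>)"
  proof (rule nn_integral_mono_AE)
    show "AE z in \<Gamma>. ennreal (infdist (snd z) K powr p) \<le>
      (case z of (y', y) \<Rightarrow> ennreal (norm (y' - y) powr p))"
      using \<open>AE z in \<Gamma>. fst z \<in> K\<close>
    proof eventually_elim
      case (elim z)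
      have "infdist (snd z) K \<le> norm (fst z - snd z)"
        using infdist_le[OF elim, of "snd z"] by (simp add: dist_norm norm_minus_commute)
      then show ?case
        using p by (auto simp: case_prod_beta infdist_nonneg intro!: ennreal_leI powr_mono2)
    qed
  qed
  finally show "(\<integral>\<^sup>+ y. ennreal (infdist y K powr p) \<partial>\<nu>) \<le>
    (\<integral>\<^sup>+ (y', y). ennreal (norm (y' - y) powr p) \<partial>\<Gamma>)" .
qed

text \<open>The graph coupling, the law of \<open>(t y, y)\<close> under \<open>\<nu>\<close>, is
  admissible and has the cost on the right.\<close>

lemma wasserstein_pow_distr_le:
  fixes \<nu> :: "'a::euclidean_space measure"
  assumes \<nu>: "\<nu> \<in> borel_probs" and t: "t \<in> borel_measurable borel"
  shows "wasserstein_pow p (distr \<nu> borel t) \<nu> \<le> (\<integral>\<^sup>+ y. ennreal (norm (t y - y) powr p) \<partial>\<nu>)"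
proof -
  have sets: "sets \<nu> = sets borel" and prob: "prob_space \<nu>"
    using \<nu> by (auto simp: borel_probs_iff)
  define \<Gamma> where "\<Gamma> = distr \<nu> borel (\<lambda>y. (t y, y))"
  have [measurable]: "t \<in> borel_measurable borel" by (fact t)
  have meas: "(\<lambda>y. (t y, y)) \<in> borel_measurable \<nu>"
    unfolding measurable_cong_sets[OF sets refl] borel_prod[symmetric] by measurable
  have fst: "fst \<in> borel_measurable (borel :: ('a \<times> 'a) measure)"
    and snd: "snd \<in> borel_measurable (borel :: ('a \<times> 'a) measure)"
    unfolding borel_prod[symmetric] by measurable
  have "distr \<Gamma> borel fst = distr \<nu> borel t"
    unfolding \<Gamma>_def by (simp add: distr_distr[OF fst meas] comp_def)
  moreover have "distr \<Gamma> borel snd = \<nu>"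
    unfolding \<Gamma>_def by (simp add: distr_distr[OF snd meas] comp_def distr_id2 sets)
  moreover have "\<Gamma> \<in> borel_probs"
    unfolding borel_probs_iff \<Gamma>_def using prob_space.prob_space_distr[OF prob meas] by simp
  ultimately have "\<Gamma> \<in> couplings (distr \<nu> borel t) \<nu>" by (simp add: couplings_def)
  then have "wasserstein_pow p (distr \<nu> borel t) \<nu> \<le>
      (\<integral>\<^sup>+ (y', y). ennreal (norm (y' - y) powr p) \<partial>\<Gamma>)"
    unfolding wasserstein_pow_def by (rule INF_lower)
  also have "\<dots> = (\<integral>\<^sup>+ y. ennreal (norm (t y - y) powr p) \<partial>\<nu>)"
    unfolding \<Gamma>_def by (subst nn_integral_distr[OF meas]) simp_all
  finally show ?thesis .
qed

theorem corollary1p3: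
  fixes p :: real
    and \<nu> :: "(real ^ 'd) measure"
    and \<phi> :: "'x::polish_space \<Rightarrow> real ^ 'd"
  assumes "p \<ge> 1"
    and "\<nu> \<in> borel_probs_moment p"
    and "\<phi> \<in> borel_measurable borel"
    and "continuous_on UNIV \<phi>"
    and "\<forall>c::real. totally_bounded {x. norm (\<phi> x) \<le> c}"
  shows "\<exists>\<sigma>. attains_inf_on (\<lambda>\<sigma>. wasserstein_pow p (distr \<sigma> borel \<phi>) \<nu>) borel_probs \<sigma>"
proof -
  have \<nu>: "\<nu> \<in> borel_probs" using assms(2) by (simp add: borel_probs_moment_def)
  then have sets: "sets \<nu> = sets borel" and prob: "prob_space \<nu>"
    by (auto simp: borel_probs_iff)
  have "closed {x. norm (\<phi> x) \<le> c}" for c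
    by (intro closed_Collect_le continuous_intros assms(4))
  then have compact: "compact {x. norm (\<phi> x) \<le> c}" for c
    using assms(5) by (simp add: totally_bounded_closed_imp_compact)
  have range: "closed (range \<phi>)"
    using closed_image_if_compact_sublevels[OF assms(4) compact closed_UNIV] .
  obtain s where s: "s \<in> borel_measurable borel"
      and near: "\<And>y. dist y (\<phi> (s y)) = infdist y (range \<phi>)"
    using nearest_value_selection[OF assms(4) compact] by blast
  \<comment> \<open>The minimum value, which does not depend on \<open>\<sigma>\<close>.\<close>
  define m where "m = (\<integral>\<^sup>+ y. ennreal (infdist y (range \<phi>) powr p) \<partial>\<nu>)"
  have lower: "m \<le> wasserstein_pow p (distr \<sigma> borel \<phi>) \<nu>" if "\<sigma> \<in> borel_probs" for \<sigma>
    unfolding m_def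
  proof (rule wasserstein_pow_ge_infdist[OF _ range])
    have "\<phi> \<in> borel_measurable \<sigma>"
      using that assms(3) by (simp add: borel_probs_iff cong: measurable_cong_sets)
    then show "AE y in distr \<sigma> borel \<phi>. y \<in> range \<phi>"
      using range by (subst AE_distr_iff) (auto intro: borel_closed)
  qed (use assms(1) in simp)
  have s': "s \<in> borel_measurable \<nu>"
    using s by (simp add: sets cong: measurable_cong_sets)
  have mem: "distr \<nu> borel s \<in> borel_probs"
    unfolding borel_probs_iff using prob_space.prob_space_distr[OF prob s'] by simp
  have "distr (distr \<nu> borel s) borel \<phi> = distr \<nu> borel (\<phi> \<circ> s)"
    by (rule distr_distr[OF assms(3) s'])
  \<comment> \<open>For \<open>t = \<phi> \<circ> s\<close> the graph coupling moves each
    \<open>y\<close> by exactly its distance to the range, so its cost is \<open>m\<close>.\<close>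
  then have "wasserstein_pow p (distr (distr \<nu> borel s) borel \<phi>) \<nu> \<le> m"
    using wasserstein_pow_distr_le[OF \<nu> measurable_comp[OF s assms(3)], of p]
    by (simp add: m_def near[symmetric] dist_norm norm_minus_commute)
  then have "wasserstein_pow p (distr (distr \<nu> borel s) borel \<phi>) \<nu> = m"
    using lower[OF mem] by (rule antisym)
  then have "attains_inf_on (\<lambda>\<sigma>. wasserstein_pow p (distr \<sigma> borel \<phi>) \<nu>) borel_probs (distr \<nu> borel s)"
    unfolding attains_inf_on_def using mem lower
    by (auto intro!: antisym INF_greatest INF_lower)
  then show ?thesis by blast
qed

end
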